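(* Let $\mu$ be a quasi-definite complex Borel measure supported on $\mathbb T$, $\vec n=(n_+,n_-)\in\mathbb Z_+^2$ and $|\vec n|=n_++n_-$. 1. The extended moment matrix $g_{\vec n}$ has the symmetry $\Upsilon_{\vec n}\,g_{\vec n}=g_{\vec n}\,\Upsilon_{\vec n}$. 2. The operator of multiplication by $z$ has a $|\vec n|+3$ diagonal band structure in the basis given by $\Phi_{\vec n,1}$ or $\Phi_{\vec n,2}$.
   Context: $\mathbb T$ is the unit circle; $\mathbb Z_+=\{0,1,2,\dots\}$; $\mu$ is quasi-definite if all Toeplitz matrices $\big(\oint_{\mathbb T}z^{i-j}d\mu\big)_{i,j=0}^n$, $n\ge0$, are non-singular. Indices start at $0$; $\dagger$ is the conjugate transpose. Extended ordering: $\chi_{\vec n}=(1,z,\dots,z^{n_+-1},z^{-1},z^{-2},\dots,z^{-n_-},z^{n_+},z^{n_++1},\dots)^\top$ (alternately $n_+$ increasing non-negative powers and $n_-$ decreasing negative powers of $z$). $g_{\vec n}=\oint_{\mathbb T}\chi_{\vec n}(z)\chi_{\vec n}(z)^\dagger d\mu(z)=S_{\vec n,1}^{-1}S_{\vec n,2}$ with $S_{\vec n,1}$ lower triangular with unit diagonal and $S_{\vec n,2}$ upper triangular; $\Phi_{\vec n,1}=S_{\vec n,1}\chi_{\vec n}$ and $\Phi_{\vec n,2}=(S_{\vec n,2}^{-1})^\dagger\chi_{\vec n}$ are the semi-infinite vectors of bi-orthogonal Laurent polynomials. Let $\{e_l\}_{l\ge0}$ be the canonical basis and $E_{i,j}$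 the matrix units. Let $e_1(k)=e_l$ where $l$ is the index with $\chi_{\vec n}^{(l)}=z^k$, and $e_2(k)=e_l$ where $\chi_{\vec n}^{(l)}=z^{-k-1}$, $k\ge0$. Put $\Lambda_{\vec n,a}=\sum_{k\ge0}e_a(k)e_a(k+1)^\top$ for $a=1,2$, $\Lambda=\sum_{j\ge0}E_{j,j+1}$, and $\Upsilon_{\vec n}=\Lambda_{\vec n,1}+\Lambda_{\vec n,2}^\top+E_{n_+,n_+}(\Lambda^\top)^{n_+}$.
   Formalization: The formal version assumes n_+ ≥ 1 and n_- ≥ 1: if n_+ = 0 or n_- = 0 the vectors e_1(k) or e_2(k) defining Υ do not exist; for n_- = 0 multiplication by z is in general a full Hessenberg matrix, and for n_+ = 0 it leaves the span of χ. *)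

theory Defs
  imports "HOL-Analysis.Analysis" "Jordan_Normal_Form.Determinant"
begin

section \<open>Complex Borel measures and integration\<close>

text \<open>A complex measure is a countably additive set function on the Borel sets of the plane; its
  values on non-Borel sets are irrelevant. Taking all \<open>A i\<close> empty yields \<open>\<mu> {} = 0\<close>.\<close>

definition complex_borel_measure :: "(complex set \<Rightarrow> complex) \<Rightarrow> bool" where
  "complex_borel_measure \<mu> \<longleftrightarrow>
     (\<forall>A :: nat \<Rightarrow> complex set. range A \<subseteq> sets borel \<and> disjoint_family A \<longrightarrow>
        (\<lambda>i. \<mu> (A i)) sums \<mu> (\<Union>i. A i))"

definition supported_on :: "(complex set \<Rightarrow> complex) \<Rightarrow> complex set \<Rightarrow> bool" where
  "supported_on \<mu> T \<longleftrightarrow> (\<forall>A \<in> sets borel. A \<inter> T = {} \<longrightarrow> \<mu> A = 0)"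

text \<open>The integral is defined through the Jordan decompositions of the real and imaginary parts.
  The positive part of a signed measure \<open>\<rho>\<close> is its upper variation, the supremum of \<open>\<rho>\<close> over the
  Borel subsets; the negative part is the upper variation of \<open>-\<rho>\<close>.\<close>

definition upper_variation :: "(complex set \<Rightarrow> real) \<Rightarrow> complex measure" where
  "upper_variation \<rho> =
     measure_of UNIV (sets borel) (\<lambda>A. SUP B \<in> {B \<in> sets borel. B \<subseteq> A}. ennreal (\<rho> B))"

definition complex_integral :: "(complex set \<Rightarrow> complex) \<Rightarrow> (complex \<Rightarrow> complex) \<Rightarrow> complex" where
  "complex_integral \<mu> f =
     ((LINT z|upper_variation (\<lambda>A. Re (\<mu> A)). f z) - (LINT z|upper_variation (\<lambda>A. - Re (\<mu> A)). f z))
     + \<i> * ((LINT z|upper_variation (\<lambda>A. Im (\<mu> A)). f z) - (LINT z|upper_variation (\<lambda>A. - Im (\<mu> A)). f z))"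

definition quasi_definite :: "(complex set \<Rightarrow> complex) \<Rightarrow> bool" where
  "quasi_definite \<mu> \<longleftrightarrow>
     (\<forall>n. Determinant.det (Matrix.mat (Suc n) (Suc n)
        (\<lambda>(i, j). complex_integral \<mu> (\<lambda>z. z powi (int i - int j)))) \<noteq> 0)"


section \<open>Semi-infinite matrices\<close>

type_synonym smat = "nat \<Rightarrow> nat \<Rightarrow> complex"

text \<open>In every product formed below, one factor has finite rows or the other has finite columns, so
  the series are finite sums.\<close>

definition smat_mult :: "smat \<Rightarrow> smat \<Rightarrow> smat"  (infixl "\<odot>" 70) where
  "A \<odot> B = (\<lambda>i j. \<Sum>k. A i k * B k j)"

definition smat_app :: "smat \<Rightarrow> (nat \<Rightarrow> complex \<Rightarrow> complex) \<Rightarrow> nat \<Rightarrow> complex \<Rightarrow> complex" where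
  "smat_app A v = (\<lambda>i z. \<Sum>k. A i k * v k z)"

definition smat_one :: smat where
  "smat_one = (\<lambda>i j. if i = j then 1 else 0)"

definition smat_power :: "smat \<Rightarrow> nat \<Rightarrow> smat" where
  "smat_power A n = (smat_mult A ^^ n) smat_one"

definition smat_transpose :: "smat \<Rightarrow> smat" where
  "smat_transpose A = (\<lambda>i j. A j i)"

definition smat_adjoint :: "smat \<Rightarrow> smat" where
  "smat_adjoint A = (\<lambda>i j. cnj (A j i))"

text \<open>For a triangular matrix with non-zero diagonal a two-sided inverse exists, is unique and is
  triangular of the same kind.\<close>

definition smat_inv :: "smat \<Rightarrow> smat" where
  "smat_inv A = (THE B. A \<odot> B = smat_one \<and> B \<odot> A = smat_one)"

definition matrix_unit :: "nat \<Rightarrow> nat \<Rightarrow> smat" where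
  "matrix_unit a b = (\<lambda>i j. if i = a \<and> j = b then 1 else 0)"

definition basis_vec :: "nat \<Rightarrow> nat \<Rightarrow> complex" where
  "basis_vec l = (\<lambda>i. if i = l then 1 else 0)"

definition unit_lower_triangular :: "smat \<Rightarrow> bool" where
  "unit_lower_triangular A \<longleftrightarrow> (\<forall>i. A i i = 1) \<and> (\<forall>i j. i < j \<longrightarrow> A i j = 0)"

definition upper_triangular_smat :: "smat \<Rightarrow> bool" where
  "upper_triangular_smat A \<longleftrightarrow> (\<forall>i j. j < i \<longrightarrow> A i j = 0)"

definition gauss_borel :: "smat \<Rightarrow> smat \<Rightarrow> smat \<Rightarrow> bool" where
  "gauss_borel g S1 S2 \<longleftrightarrow>
     unit_lower_triangular S1 \<and> upper_triangular_smat S2 \<and> g = smat_inv S1 \<odot> S2"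

definition gauss_factors :: "smat \<Rightarrow> smat \<times> smat" where
  "gauss_factors g = (THE (S1, S2). gauss_borel g S1 S2)"

definition banded :: "nat \<Rightarrow> smat \<Rightarrow> bool" where
  "banded d J \<longleftrightarrow>
     (\<exists>p q. p + q + 1 = d \<and> (\<forall>i j. J i j \<noteq> 0 \<longrightarrow> i \<le> j + p \<and> j \<le> i + q))"


section \<open>The extended ordering and the Laurent polynomials\<close>

text \<open>Position \<open>l\<close> lies in block number \<open>l div (np + nm)\<close>. Each block consists of the next \<open>np\<close>
  non-negative exponents followed by the next \<open>nm\<close> negative ones.\<close>

definition chi_exp :: "nat \<Rightarrow> nat \<Rightarrow> nat \<Rightarrow> int" where
  "chi_exp np nm l =
     (let q = l div (np + nm); r = l mod (np + nm)
      in if r < np then int (q * np + r) else - int (q * nm + (r - np) + 1))"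

definition chi :: "nat \<Rightarrow> nat \<Rightarrow> nat \<Rightarrow> complex \<Rightarrow> complex" where
  "chi np nm l z = z powi chi_exp np nm l"

definition moment_matrix :: "(complex set \<Rightarrow> complex) \<Rightarrow> nat \<Rightarrow> nat \<Rightarrow> smat" where
  "moment_matrix \<mu> np nm = (\<lambda>i j. complex_integral \<mu> (\<lambda>z. chi np nm i z * cnj (chi np nm j z)))"

definition S1 :: "(complex set \<Rightarrow> complex) \<Rightarrow> nat \<Rightarrow> nat \<Rightarrow> smat" where
  "S1 \<mu> np nm = fst (gauss_factors (moment_matrix \<mu> np nm))"

definition S2 :: "(complex set \<Rightarrow> complex) \<Rightarrow> nat \<Rightarrow> nat \<Rightarrow> smat" where
  "S2 \<mu> np nm = snd (gauss_factors (moment_matrix \<mu> np nm))"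

definition Phi1 :: "(complex set \<Rightarrow> complex) \<Rightarrow> nat \<Rightarrow> nat \<Rightarrow> nat \<Rightarrow> complex \<Rightarrow> complex" where
  "Phi1 \<mu> np nm = smat_app (S1 \<mu> np nm) (chi np nm)"

definition Phi2 :: "(complex set \<Rightarrow> complex) \<Rightarrow> nat \<Rightarrow> nat \<Rightarrow> nat \<Rightarrow> complex \<Rightarrow> complex" where
  "Phi2 \<mu> np nm = smat_app (smat_adjoint (smat_inv (S2 \<mu> np nm))) (chi np nm)"

text \<open>\<open>J\<close> is the matrix of multiplication by \<open>z\<close> with respect to \<open>\<Phi>\<close>, that is \<open>z \<Phi> = J \<Phi>\<close>, the
  expansions being finite. Laurent polynomials are regarded as functions on the punctured plane,
  because \<open>powi\<close> with a negative exponent is a junk value at \<open>0\<close>.\<close>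

definition mult_z_matrix :: "(nat \<Rightarrow> complex \<Rightarrow> complex) \<Rightarrow> smat \<Rightarrow> bool" where
  "mult_z_matrix \<Phi> J \<longleftrightarrow>
     (\<forall>i. finite {j. J i j \<noteq> 0}) \<and>
     (\<forall>i z. z \<noteq> 0 \<longrightarrow> z * \<Phi> i z = smat_app J \<Phi> i z)"

text \<open>Uniqueness of \<open>J\<close> is what makes it legitimate to speak of the matrix of the operator in the
  basis \<open>\<Phi>\<close>.\<close>

definition mult_z_band_structure :: "nat \<Rightarrow> (nat \<Rightarrow> complex \<Rightarrow> complex) \<Rightarrow> bool" where
  "mult_z_band_structure d \<Phi> \<longleftrightarrow>
     (\<exists>!J. mult_z_matrix \<Phi> J) \<and> (\<forall>J. mult_z_matrix \<Phi> J \<longrightarrow> banded d J)"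


section \<open>The shift matrices\<close>

text \<open>Every integer is the exponent at exactly one position precisely when \<open>np \<ge> 1\<close> and \<open>nm \<ge> 1\<close>;
  otherwise the non-negative, respectively negative, powers do not all occur and the vectors below
  are not defined.\<close>

definition chi_index :: "nat \<Rightarrow> nat \<Rightarrow> int \<Rightarrow> nat" where
  "chi_index np nm m = (THE l. chi_exp np nm l = m)"

definition e1 :: "nat \<Rightarrow> nat \<Rightarrow> nat \<Rightarrow> nat \<Rightarrow> complex" where
  "e1 np nm k = basis_vec (chi_index np nm (int k))"

definition e2 :: "nat \<Rightarrow> nat \<Rightarrow> nat \<Rightarrow> nat \<Rightarrow> complex" where
  "e2 np nm k = basis_vec (chi_index np nm (- int k - 1))"

definition Lambda1 :: "nat \<Rightarrow> nat \<Rightarrow> smat" where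
  "Lambda1 np nm = (\<lambda>i j. \<Sum>k. e1 np nm k i * e1 np nm (k + 1) j)"

definition Lambda2 :: "nat \<Rightarrow> nat \<Rightarrow> smat" where
  "Lambda2 np nm = (\<lambda>i j. \<Sum>k. e2 np nm k i * e2 np nm (k + 1) j)"

definition Lambda :: smat where
  "Lambda = (\<lambda>i j. \<Sum>k. matrix_unit k (k + 1) i j)"

definition Upsilon :: "nat \<Rightarrow> nat \<Rightarrow> smat" where
  "Upsilon np nm = (\<lambda>i j. Lambda1 np nm i j + smat_transpose (Lambda2 np nm) i j
     + (matrix_unit np np \<odot> smat_power (smat_transpose Lambda) np) i j)"

end

theory Submission
  imports Defs
begin

text \<open>On the unit circle \<open>cnj z = z\<^sup>-\<^sup>1\<close>, so for a measure living there the entry \<open>(i, j)\<close> of the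
  moment matrix depends only on the difference of the exponents at the positions \<open>i\<close> and \<open>j\<close>. The
  matrix \<open>\<Upsilon>\<close> is multiplication by \<open>z\<close> in the basis \<open>\<chi>\<close>: its entry \<open>(i, j)\<close> is \<open>1\<close> if the exponent at
  \<open>j\<close> is one more than that at \<open>i\<close>, and \<open>0\<close> otherwise (\<open>Upsilon_entry\<close>). Multiplying \<open>g\<close> by \<open>\<Upsilon>\<close>
  on the left raises the exponent of the row, multiplying on the right lowers that of the column;
  both raise the difference by one, which is the symmetry \<open>\<Upsilon> g = g \<Upsilon>\<close> (\<open>Upsilon_commutes\<close>).

  The first \<open>n\<close> exponents in the extended ordering form an interval of integers, so the sections of
  \<open>g\<close> are simultaneous row and column permutations of Toeplitz sections and are non-singular by
  quasi-definiteness (\<open>section_det_moment_matrix\<close>). Hence the factorization \<open>g = S\<^sub>1\<^sup>-\<^sup>1 S\<^sub>2\<close> exists and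
  is unique (\<open>gauss_factors_properties\<close>).

  In the basis \<open>\<Phi>\<^sub>1 = S\<^sub>1 \<chi>\<close> multiplication by \<open>z\<close> has the matrix \<open>S\<^sub>1 \<Upsilon> S\<^sub>1\<^sup>-\<^sup>1\<close>, and by the symmetry
  this equals \<open>S\<^sub>2 \<Upsilon> S\<^sub>2\<^sup>-\<^sup>1\<close>. Conjugation by a lower triangular matrix does not enlarge the upper
  bandwidth and conjugation by an upper triangular one does not enlarge the lower bandwidth, so the
  result has at most the \<open>n\<^sub>- + 1\<close> superdiagonals and the \<open>n\<^sub>+ + 1\<close> subdiagonals of \<open>\<Upsilon>\<close>
  (\<open>Upsilon_band\<close>), in total \<open>n\<^sub>+ + n\<^sub>- + 3\<close> diagonals with the main one. For \<open>\<Phi>\<^sub>2\<close> the same argument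
  applies to the adjoint of \<open>g\<close>, whose entries again depend only on differences of exponents: taking adjoints in \<open>g S\<^sub>2\<^sup>-\<^sup>1 = S\<^sub>1\<^sup>-\<^sup>1\<close>, the lower triangular
  \<open>(S\<^sub>2\<^sup>-\<^sup>1)\<^sup>\<dagger>\<close> takes \<open>g\<^sup>\<dagger>\<close> to the upper triangular \<open>(S\<^sub>1\<^sup>-\<^sup>1)\<^sup>\<dagger>\<close>. Both cases are instances of
  \<open>mult_z_band_structure_triangular_basis\<close>. The matrix is unique because
  the Laurent monomials are linearly independent as functions on the punctured plane and the
  triangular change of basis is invertible.\<close>


section \<open>Semi-infinite matrices with finite rows or columns\<close>

definition row_finite :: "smat \<Rightarrow> bool" where
  "row_finite A \<longleftrightarrow> (\<forall>i. finite {j. A i j \<noteq> 0})"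

definition col_finite :: "smat \<Rightarrow> bool" where
  "col_finite A \<longleftrightarrow> (\<forall>j. finite {i. A i j \<noteq> 0})"

definition lower_triangular_smat :: "smat \<Rightarrow> bool" where
  "lower_triangular_smat A \<longleftrightarrow> (\<forall>i j. i < j \<longrightarrow> A i j = 0)"

definition nonzero_diagonal :: "smat \<Rightarrow> bool" where
  "nonzero_diagonal A \<longleftrightarrow> (\<forall>i. A i i \<noteq> 0)"

lemma row_finite_transpose [simp]: "row_finite (smat_transpose A) \<longleftrightarrow> col_finite A"
  by (simp add: row_finite_def col_finite_def smat_transpose_def)

lemma transpose_transpose [simp]: "smat_transpose (smat_transpose A) = A"
  by (simp add: smat_transpose_def)

lemma transpose_one [simp]: "smat_transpose smat_one = smat_one"
  by (intro ext) (simp add: smat_transpose_def smat_one_def eq_commute)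

lemma transpose_mult: "smat_transpose (A \<odot> B) = smat_transpose B \<odot> smat_transpose A"
  by (simp add: smat_transpose_def smat_mult_def mult.commute)

lemma lower_transpose [simp]:
  "lower_triangular_smat (smat_transpose A) \<longleftrightarrow> upper_triangular_smat A"
  by (auto simp: lower_triangular_smat_def upper_triangular_smat_def smat_transpose_def)

lemma upper_transpose [simp]:
  "upper_triangular_smat (smat_transpose A) \<longleftrightarrow> lower_triangular_smat A"
  by (auto simp: lower_triangular_smat_def upper_triangular_smat_def smat_transpose_def)

lemma lower_adjoint [simp]:
  "lower_triangular_smat (smat_adjoint A) \<longleftrightarrow> upper_triangular_smat A"
  by (auto simp: lower_triangular_smat_def upper_triangular_smat_def smat_adjoint_def)

lemma upper_adjoint [simp]:
  "upper_triangular_smat (smat_adjoint A) \<longleftrightarrow> lower_triangular_smat A"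
  by (auto simp: lower_triangular_smat_def upper_triangular_smat_def smat_adjoint_def)

lemma nonzero_diagonal_transpose [simp]:
  "nonzero_diagonal (smat_transpose A) \<longleftrightarrow> nonzero_diagonal A"
  by (simp add: nonzero_diagonal_def smat_transpose_def)

lemma lower_row_finite: "lower_triangular_smat A \<Longrightarrow> row_finite A"
  unfolding row_finite_def lower_triangular_smat_def
  by (metis (mono_tags, lifting) finite_nat_set_iff_bounded_le linorder_not_le mem_Collect_eq)

lemma upper_col_finite: "upper_triangular_smat A \<Longrightarrow> col_finite A"
  using lower_row_finite[of "smat_transpose A"] by simp

lemma mult_eq_sum:
  assumes "finite F" "\<And>k. k \<notin> F \<Longrightarrow> A i k * B k j = 0"
  shows "(A \<odot> B) i j = (\<Sum>k\<in>F. A i k * B k j)"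
  unfolding smat_mult_def by (rule suminf_finite) (use assms in auto)

lemma mult_lower_eq_sum:
  assumes "lower_triangular_smat A"
  shows "(A \<odot> B) i j = (\<Sum>k<Suc i. A i k * B k j)"
  by (rule mult_eq_sum) (use assms in \<open>auto simp: lower_triangular_smat_def\<close>)

lemma mult_one_left [simp]: "smat_one \<odot> A = A"
proof (intro ext)
  fix i j
  have "(smat_one \<odot> A) i j = (\<Sum>k\<in>{i}. smat_one i k * A k j)"
    by (rule mult_eq_sum) (auto simp: smat_one_def)
  then show "(smat_one \<odot> A) i j = A i j" by (simp add: smat_one_def)
qed

lemma mult_one_right [simp]: "A \<odot> smat_one = A"
  using transpose_mult[of A smat_one] by (metis mult_one_left transpose_one transpose_transpose)

text \<open>Associativity fails for semi-infinite matrices in general. It holds at an entry as soon as the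
  double series defining it reduces to a finite double sum, whose order of summation can be
  exchanged. The three corollaries are the three ways of placing the finiteness conditions.\<close>

lemma mult_assoc_at:
  assumes F: "finite F" "\<And>k. k \<notin> F \<Longrightarrow> A i k = 0"
    and G: "finite G" "\<And>k l. k \<in> F \<Longrightarrow> l \<notin> G \<Longrightarrow> B k l * C l j = 0"
  shows "((A \<odot> B) \<odot> C) i j = (A \<odot> (B \<odot> C)) i j"
proof -
  have AB: "(A \<odot> B) i l = (\<Sum>k\<in>F. A i k * B k l)" for l
    by (rule mult_eq_sum) (use F in auto)
  have BC: "(B \<odot> C) k j = (\<Sum>l\<in>G. B k l * C l j)" if "k \<in> F" for k
    by (rule mult_eq_sum) (use G that in auto)
  have "((A \<odot> B) \<odot> C) i j = (\<Sum>l\<in>G. (A \<odot> B) i l * C l j)"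
  proof (rule mult_eq_sum[OF G(1)])
    fix l assume "l \<notin> G"
    then show "(A \<odot> B) i l * C l j = 0"
      by (simp add: AB sum_distrib_right mult.assoc G(2))
  qed
  also have "\<dots> = (\<Sum>l\<in>G. \<Sum>k\<in>F. A i k * (B k l * C l j))"
    by (simp add: AB sum_distrib_right mult.assoc)
  also have "\<dots> = (\<Sum>k\<in>F. \<Sum>l\<in>G. A i k * (B k l * C l j))"
    by (rule sum.swap)
  also have "\<dots> = (\<Sum>k\<in>F. A i k * (B \<odot> C) k j)"
    by (simp add: BC sum_distrib_left)
  also have "\<dots> = (A \<odot> (B \<odot> C)) i j"
    by (rule mult_eq_sum[symmetric]) (use F in auto)
  finally show ?thesis .
qed

lemma mult_assoc_row:
  assumes "row_finite A" "row_finite B"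
  shows "(A \<odot> B) \<odot> C = A \<odot> (B \<odot> C)"
proof (intro ext mult_assoc_at)
  fix i
  show "finite {k. A i k \<noteq> 0}" "finite (\<Union>k\<in>{k. A i k \<noteq> 0}. {l. B k l \<noteq> 0})"
    using assms by (auto simp: row_finite_def)
qed auto

lemma mult_assoc_col:
  assumes "col_finite B" "col_finite C"
  shows "(A \<odot> B) \<odot> C = A \<odot> (B \<odot> C)"
proof -
  have "smat_transpose ((A \<odot> B) \<odot> C) = smat_transpose (A \<odot> (B \<odot> C))"
    using assms mult_assoc_row[of "smat_transpose C" "smat_transpose B" "smat_transpose A"]
    by (simp add: transpose_mult)
  then show ?thesis by (metis transpose_transpose)
qed

lemma mult_assoc_row_col:
  assumes "row_finite A" "col_finite C"
  shows "(A \<odot> B) \<odot> C = A \<odot> (B \<odot> C)"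
proof (intro ext mult_assoc_at)
  fix i j
  show "finite {k. A i k \<noteq> 0}" "finite {l. C l j \<noteq> 0}"
    using assms by (auto simp: row_finite_def col_finite_def)
qed auto

lemma row_finite_mult:
  assumes "row_finite A" "row_finite B"
  shows "row_finite (A \<odot> B)"
  unfolding row_finite_def
proof
  fix i
  let ?F = "{k. A i k \<noteq> 0}"
  have F: "finite ?F" using assms by (simp add: row_finite_def)
  have "(A \<odot> B) i j = (\<Sum>k\<in>?F. A i k * B k j)" for j
    by (rule mult_eq_sum[OF F]) auto
  then have "{j. (A \<odot> B) i j \<noteq> 0} \<subseteq> (\<Union>k\<in>?F. {j. B k j \<noteq> 0})"
    by (auto elim!: sum.not_neutral_contains_not_neutral)
  moreover have "finite (\<Union>k\<in>?F. {j. B k j \<noteq> 0})"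
    using F assms by (auto simp: row_finite_def)
  ultimately show "finite {j. (A \<odot> B) i j \<noteq> 0}" by (rule finite_subset)
qed

lemma adjoint_mult:
  assumes "col_finite B"
  shows "smat_adjoint (A \<odot> B) = smat_adjoint B \<odot> smat_adjoint A"
proof (intro ext)
  fix i j
  let ?F = "{k. B k i \<noteq> 0}"
  have F: "finite ?F" using assms by (simp add: col_finite_def)
  have "(A \<odot> B) j i = (\<Sum>k\<in>?F. A j k * B k i)"
    by (rule mult_eq_sum[OF F]) auto
  moreover have "(smat_adjoint B \<odot> smat_adjoint A) i j
      = (\<Sum>k\<in>?F. smat_adjoint B i k * smat_adjoint A k j)"
    by (rule mult_eq_sum[OF F]) (auto simp: smat_adjoint_def)
  ultimately show "smat_adjoint (A \<odot> B) i j = (smat_adjoint B \<odot> smat_adjoint A) i j"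
    by (simp add: smat_adjoint_def mult.commute)
qed

lemma lower_mult:
  assumes "lower_triangular_smat A" "lower_triangular_smat B"
  shows "lower_triangular_smat (A \<odot> B)" "(A \<odot> B) i i = A i i * B i i"
proof -
  have "(A \<odot> B) i j = (\<Sum>k<Suc i. A i k * B k j)" for i j
    using assms by (simp add: mult_lower_eq_sum)
  moreover have "(\<Sum>k<Suc i. A i k * B k j) = 0" if "i < j" for i j
    using assms that by (intro sum.neutral) (auto simp: lower_triangular_smat_def)
  moreover have "(\<Sum>k<Suc i. A i k * B k i) = A i i * B i i"
  proof -
    have "(\<Sum>k<i. A i k * B k i) = 0"
      using assms by (intro sum.neutral) (auto simp: lower_triangular_smat_def)
    then show ?thesis by simp
  qed
  ultimately show "lower_triangular_smat (A \<odot> B)" "(A \<odot> B) i i = A i i * B i i"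
    by (auto simp: lower_triangular_smat_def)
qed


section \<open>Gauss--Borel factorization\<close>

definition section_det :: "smat \<Rightarrow> nat \<Rightarrow> complex" where
  "section_det g n = Determinant.det (Matrix.mat n n (\<lambda>(i, j). g i j))"

lemma finite_section_inverse:
  assumes "section_det g n \<noteq> 0"
  obtains B where
    "\<And>i j. i < n \<Longrightarrow> j < n \<Longrightarrow> (\<Sum>k<n. g i k * B k j) = (if i = j then 1 else 0)"
    "\<And>i j. i < n \<Longrightarrow> j < n \<Longrightarrow> (\<Sum>k<n. B i k * g k j) = (if i = j then 1 else 0)"
proof -
  let ?A = "Matrix.mat n n (\<lambda>(i, j). g i j)"
  have A: "?A \<in> carrier_mat n n" by simp
  have "?A \<in> Units (ring_mat TYPE(complex) n ())"
    using assms by (intro det_non_zero_imp_unit[OF A]) (simp add: section_det_def)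
  then obtain B where B: "B \<in> carrier_mat n n" "B * ?A = 1\<^sub>m n" "?A * B = 1\<^sub>m n"
    unfolding Units_def ring_mat_def by auto
  show thesis
  proof (rule that[of "\<lambda>i j. B $$ (i, j)"])
    fix i j assume ij: "i < n" "j < n"
    have "(?A * B) $$ (i, j) = (\<Sum>k<n. g i k * B $$ (k, j))"
      using ij B(1) by (simp add: scalar_prod_def lessThan_atLeast0)
    then show "(\<Sum>k<n. g i k * B $$ (k, j)) = (if i = j then 1 else 0)"
      using ij by (simp add: B(3))
    have "(B * ?A) $$ (i, j) = (\<Sum>k<n. B $$ (i, k) * g k j)"
      using ij B(1) by (simp add: scalar_prod_def lessThan_atLeast0)
    then show "(\<Sum>k<n. B $$ (i, k) * g k j) = (if i = j then 1 else 0)"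
      using ij by (simp add: B(2))
  qed
qed

lemma finite_section_solvable:
  assumes "section_det g n \<noteq> 0"
  shows "\<exists>x. \<forall>j<n. (\<Sum>k<n. x k * g k j) = b j"
proof -
  obtain B where B: "\<And>i j. i < n \<Longrightarrow> j < n \<Longrightarrow> (\<Sum>k<n. B i k * g k j) = (if i = j then 1 else 0)"
    using finite_section_inverse[OF assms] by metis
  have "(\<Sum>k<n. (\<Sum>l<n. b l * B l k) * g k j) = b j" if "j < n" for j
  proof -
    have "(\<Sum>k<n. (\<Sum>l<n. b l * B l k) * g k j) = (\<Sum>k<n. \<Sum>l<n. b l * (B l k * g k j))"
      by (simp add: sum_distrib_right mult.assoc)
    also have "\<dots> = (\<Sum>l<n. b l * (\<Sum>k<n. B l k * g k j))"
      by (subst sum.swap) (simp add: sum_distrib_left)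
    also have "\<dots> = (\<Sum>l<n. if l = j then b l else 0)"
      using that by (intro sum.cong) (auto simp: B)
    finally show ?thesis using that by simp
  qed
  then show ?thesis by (intro exI[of _ "\<lambda>k. \<Sum>l<n. b l * B l k"]) simp
qed

lemma finite_section_kernel:
  assumes "section_det g n \<noteq> 0" "\<And>j. j < n \<Longrightarrow> (\<Sum>k<n. x k * g k j) = 0" "i < n"
  shows "x i = 0"
proof -
  obtain B where B: "\<And>i j. i < n \<Longrightarrow> j < n \<Longrightarrow> (\<Sum>k<n. g i k * B k j) = (if i = j then 1 else 0)"
    using finite_section_inverse[OF assms(1)] by metis
  have "0 = (\<Sum>j<n. (\<Sum>k<n. x k * g k j) * B j i)" by (simp add: assms(2))
  also have "\<dots> = (\<Sum>j<n. \<Sum>k<n. x k * (g k j * B j i))"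
    by (simp add: sum_distrib_right mult.assoc)
  also have "\<dots> = (\<Sum>k<n. x k * (\<Sum>j<n. g k j * B j i))"
    by (subst sum.swap) (simp add: sum_distrib_left)
  also have "\<dots> = (\<Sum>k<n. if k = i then x k else 0)"
    using assms(3) by (intro sum.cong) (auto simp: B)
  finally show ?thesis using assms(3) by simp
qed

text \<open>Row \<open>i\<close> of the lower factor is \<open>(x 0, \<dots>, x (i-1), 1, 0, \<dots>)\<close>, where \<open>x\<close> solves the linear
  system with the \<open>i\<close>-th section of \<open>g\<close> that makes the entries of the product to the left of the
  diagonal vanish. Were the diagonal entry of the product zero as well, this row would lie in the
  kernel of the next section.\<close>

lemma triangular_reduction:
  assumes "\<And>n. section_det g n \<noteq> 0"
  shows "\<exists>L. unit_lower_triangular L \<and> upper_triangular_smat (L \<odot> g) \<and> nonzero_diagonal (L \<odot> g)"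
proof -
  have "\<exists>x. \<forall>j<i. (\<Sum>k<i. x k * g k j) = - g i j" for i
    using finite_section_solvable[OF assms] .
  then obtain x where x: "\<And>i j. j < i \<Longrightarrow> (\<Sum>k<i. x i k * g k j) = - g i j"
    by metis
  define L :: smat where "L = (\<lambda>i k. if k < i then x i k else if k = i then 1 else 0)"
  have unit: "unit_lower_triangular L" by (auto simp: L_def unit_lower_triangular_def)
  then have low: "lower_triangular_smat L"
    by (simp add: unit_lower_triangular_def lower_triangular_smat_def)
  have prod: "(L \<odot> g) i j = (\<Sum>k<Suc i. L i k * g k j)" for i j
    by (rule mult_lower_eq_sum[OF low])
  have zero: "(L \<odot> g) i j = 0" if "j < i" for i j
  proof -
    have "(\<Sum>k<i. L i k * g k j) = (\<Sum>k<i. x i k * g k j)"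
      by (rule sum.cong) (auto simp: L_def)
    moreover have "L i i = 1" by (simp add: L_def)
    ultimately have "(\<Sum>k<Suc i. L i k * g k j) = - g i j + g i j"
      using x[OF that] by (simp only: sum.lessThan_Suc mult_1)
    then show ?thesis by (simp only: prod add.left_inverse)
  qed
  have "(L \<odot> g) i i \<noteq> 0" for i
  proof
    assume "(L \<odot> g) i i = 0"
    then have "(\<Sum>k<Suc i. L i k * g k j) = 0" if "j < Suc i" for j
      using zero[of j i] that \<open>(L \<odot> g) i i = 0\<close> unfolding prod[symmetric]
      by (cases "j = i") simp_all
    then have "L i i = 0"
      using finite_section_kernel[OF assms[of "Suc i"], of "L i" i] by blast
    then show False by (simp add: L_def)
  qed
  then show ?thesis using unit zero by (auto simp: upper_triangular_smat_def nonzero_diagonal_def)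
qed

lemma triangular_reduction_unique:
  assumes "\<And>n. section_det g n \<noteq> 0"
    and "unit_lower_triangular L" "upper_triangular_smat (L \<odot> g)"
    and "unit_lower_triangular M" "upper_triangular_smat (M \<odot> g)"
  shows "L = M"
proof (intro ext)
  fix i k
  have eq: "(\<Sum>k<i. A i k * g k j) = - g i j"
    if "unit_lower_triangular A" "upper_triangular_smat (A \<odot> g)" "j < i" for A j
  proof -
    have "(A \<odot> g) i j = (\<Sum>k<Suc i. A i k * g k j)"
      using that(1) by (intro mult_lower_eq_sum)
        (simp add: unit_lower_triangular_def lower_triangular_smat_def)
    moreover have "(A \<odot> g) i j = 0" using that by (simp add: upper_triangular_smat_def)
    ultimately show ?thesis
      using that(1) by (simp add: unit_lower_triangular_def eq_neg_iff_add_eq_0)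
  qed
  show "L i k = M i k"
  proof (cases "k < i")
    case True
    have "L i k - M i k = 0"
    proof (rule finite_section_kernel[where x = "\<lambda>k. L i k - M i k", OF assms(1)[of i] _ True])
      fix j assume "j < i"
      then show "(\<Sum>k<i. (L i k - M i k) * g k j) = 0"
        using eq[OF assms(2,3)] eq[OF assms(4,5)] by (simp add: left_diff_distrib sum_subtractf)
    qed
    then show ?thesis by simp
  next
    case False
    then show ?thesis using assms(2,4)
      by (cases "k = i") (auto simp: unit_lower_triangular_def)
  qed
qed

text \<open>A triangular matrix has a triangular inverse by the reduction above: its sections have
  non-zero determinant, and for a lower triangular \<open>A\<close> the reduced matrix is both lower and upper
  triangular, hence diagonal. This gives a left inverse, which itself has a left inverse, so it is
  two-sided.\<close>

lemma lower_left_inverse: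
  assumes "lower_triangular_smat A" "nonzero_diagonal A"
  shows "\<exists>B. lower_triangular_smat B \<and> nonzero_diagonal B \<and> B \<odot> A = smat_one"
proof -
  have "section_det A n \<noteq> 0" for n
  proof -
    have "section_det A n
        = prod_list (diag_mat (Matrix.mat n n (\<lambda>(i, j). A i j)))"
      unfolding section_det_def
      by (rule det_lower_triangular[of n]) (use assms(1) in \<open>auto simp: lower_triangular_smat_def\<close>)
    also have "\<dots> \<noteq> 0"
      using assms(2) by (auto simp: diag_mat_def prod_list_zero_iff nonzero_diagonal_def)
    finally show ?thesis .
  qed
  then obtain L where L: "unit_lower_triangular L" "upper_triangular_smat (L \<odot> A)"
      "nonzero_diagonal (L \<odot> A)"
    using triangular_reduction by blast
  have low: "lower_triangular_smat L"
    using L(1) by (simp add: unit_lower_triangular_def lower_triangular_smat_def)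
  define B where "B = (\<lambda>i j. L i j / (L \<odot> A) i i)"
  have B: "lower_triangular_smat B" "nonzero_diagonal B"
    using low L(1,3)
    by (auto simp: B_def lower_triangular_smat_def nonzero_diagonal_def unit_lower_triangular_def)
  have "(B \<odot> A) i j = (L \<odot> A) i j / (L \<odot> A) i i" for i j
    by (simp only: mult_lower_eq_sum[OF B(1)] mult_lower_eq_sum[OF low])
      (simp add: B_def sum_divide_distrib add_divide_distrib mult_lower_eq_sum[OF low])
  moreover have "(L \<odot> A) i j = 0" if "i \<noteq> j" for i j
    using that L(2) lower_mult(1)[OF low assms(1)]
    by (cases "i < j") (auto simp: lower_triangular_smat_def upper_triangular_smat_def)
  ultimately have "B \<odot> A = smat_one"
    using L(3) by (auto simp: smat_one_def nonzero_diagonal_def fun_eq_iff)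
  with B show ?thesis by blast
qed

lemma lower_inverse:
  assumes "lower_triangular_smat A" "nonzero_diagonal A"
  obtains B where "lower_triangular_smat B" "nonzero_diagonal B"
    "A \<odot> B = smat_one" "B \<odot> A = smat_one"
proof -
  obtain B where B: "lower_triangular_smat B" "nonzero_diagonal B" "B \<odot> A = smat_one"
    using lower_left_inverse[OF assms] by blast
  obtain C where C: "lower_triangular_smat C" "C \<odot> B = smat_one"
    using lower_left_inverse[OF B(1,2)] by blast
  have "(C \<odot> B) \<odot> A = C \<odot> (B \<odot> A)"
    by (intro mult_assoc_row lower_row_finite B C)
  then have "C = A" using B(3) C(2) by simp
  with B C that show thesis by metis
qed

lemma upper_inverse:
  assumes "upper_triangular_smat A" "nonzero_diagonal A"
  obtains B where "upper_triangular_smat B" "nonzero_diagonal B"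
    "A \<odot> B = smat_one" "B \<odot> A = smat_one"
proof -
  obtain B where B: "lower_triangular_smat B" "nonzero_diagonal B"
    "smat_transpose A \<odot> B = smat_one" "B \<odot> smat_transpose A = smat_one"
    using lower_inverse[of "smat_transpose A"] assms by auto
  show thesis
  proof (rule that[of "smat_transpose B"])
    show "A \<odot> smat_transpose B = smat_one" "smat_transpose B \<odot> A = smat_one"
      using B(3,4) by (metis transpose_mult transpose_one transpose_transpose)+
  qed (use B in auto)
qed

lemma smat_inv_lower:
  assumes "lower_triangular_smat A" "lower_triangular_smat B"
    and "A \<odot> B = smat_one" "B \<odot> A = smat_one"
  shows "smat_inv A = B"
  unfolding smat_inv_def
proof (rule the_equality)
  fix C assume "A \<odot> C = smat_one \<and> C \<odot> A = smat_one"
  moreover have "(B \<odot> A) \<odot> C = B \<odot> (A \<odot> C)"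
    by (intro mult_assoc_row lower_row_finite assms)
  ultimately show "C = B" using assms by simp
qed (use assms in simp)

lemma smat_inv_upper:
  assumes "upper_triangular_smat A" "upper_triangular_smat B"
    and "A \<odot> B = smat_one" "B \<odot> A = smat_one"
  shows "smat_inv A = B"
  unfolding smat_inv_def
proof (rule the_equality)
  fix C assume "A \<odot> C = smat_one \<and> C \<odot> A = smat_one"
  moreover have "(C \<odot> A) \<odot> B = C \<odot> (A \<odot> B)"
    by (intro mult_assoc_col upper_col_finite assms)
  ultimately show "C = B" using assms by simp
qed (use assms in simp)

text \<open>Moving \<open>S\<^sub>1\<^sup>-\<^sup>1\<close> to the other side turns the factorization problem into the triangular reduction
  of \<open>g\<close> above.\<close>

lemma gauss_borel_iff:
  "gauss_borel g L U \<longleftrightarrow>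
     unit_lower_triangular L \<and> upper_triangular_smat U \<and> L \<odot> g = U"
proof (cases "unit_lower_triangular L")
  case True
  then have L: "lower_triangular_smat L" "nonzero_diagonal L"
    by (auto simp: unit_lower_triangular_def lower_triangular_smat_def nonzero_diagonal_def)
  obtain B where B: "lower_triangular_smat B" "L \<odot> B = smat_one" "B \<odot> L = smat_one"
    using lower_inverse[OF L] .
  have "smat_inv L = B" by (rule smat_inv_lower[OF L(1) B])
  moreover have "(L \<odot> B) \<odot> X = L \<odot> (B \<odot> X)" "(B \<odot> L) \<odot> X = B \<odot> (L \<odot> X)" for X
    by (intro mult_assoc_row lower_row_finite B L)+
  ultimately show ?thesis using B by (auto simp: gauss_borel_def)
qed (simp add: gauss_borel_def)

lemma gauss_factors_properties:
  assumes "\<And>n. section_det g n \<noteq> 0" "gauss_factors g = (L, U)"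
  shows "unit_lower_triangular L" "upper_triangular_smat U" "nonzero_diagonal U" "L \<odot> g = U"
proof -
  obtain L' where L': "unit_lower_triangular L'" "upper_triangular_smat (L' \<odot> g)"
      "nonzero_diagonal (L' \<odot> g)"
    using triangular_reduction[OF assms(1)] by blast
  have "gauss_factors g = (L', L' \<odot> g)"
    unfolding gauss_factors_def
  proof (rule the_equality)
    show "case (L', L' \<odot> g) of (L, U) \<Rightarrow> gauss_borel g L U"
      using L' by (simp add: gauss_borel_iff)
    fix p assume "case p of (L, U) \<Rightarrow> gauss_borel g L U"
    then show "p = (L', L' \<odot> g)"
      using triangular_reduction_unique[OF assms(1) _ _ L'(1,2)]
      by (auto simp: gauss_borel_iff split: prod.splits)
  qed
  then show "unit_lower_triangular L" "upper_triangular_smat U" "nonzero_diagonal U" "L \<odot> g = U"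
    using L' assms(2) by auto
qed


section \<open>The extended ordering of the exponents\<close>

lemma block_div:
  fixes q r d :: nat
  assumes "r < d"
  shows "(q * d + r) div d = q"
proof -
  have "(r + q * d) div d = q + r div d" using assms by (intro div_mult_self1) auto
  then show ?thesis using assms by (simp add: add.commute)
qed

lemma chi_exp_block:
  assumes "r < np + nm"
  shows "chi_exp np nm (q * (np + nm) + r)
    = (if r < np then int (q * np + r) else - int (q * nm + (r - np) + 1))"
proof -
  have "(q * (np + nm) + r) div (np + nm) = q" "(q * (np + nm) + r) mod (np + nm) = r"
    using assms by (simp_all add: block_div)
  then show ?thesis by (simp add: chi_exp_def Let_def)
qed

lemma position_block:
  assumes "np \<ge> 1"
  obtains q r :: nat where "l = q * (np + nm) + r" "r < np + nm"
proof (rule that)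
  show "l = l div (np + nm) * (np + nm) + l mod (np + nm)" by (rule div_mult_mod_eq[symmetric])
  show "l mod (np + nm) < np + nm" using assms by simp
qed

lemma block_number_unique:
  fixes q r q' r' d :: nat
  assumes "q * d + r = q' * d + r'" "r < d" "r' < d"
  shows "q = q'" "r = r'"
proof -
  have "(q * d + r) div d = q" "(q' * d + r') div d = q'" using assms(2,3) by (simp_all only: block_div)
  then show "q = q'" using assms(1) by simp
  with assms(1) show "r = r'" by simp
qed

lemma chi_exp_inj:
  assumes np: "np \<ge> 1" and eq: "chi_exp np nm l = chi_exp np nm l'"
  shows "l = l'"
proof -
  obtain q r where l: "l = q * (np + nm) + r" "r < np + nm" by (rule position_block[OF np])
  obtain q' r' where l': "l' = q' * (np + nm) + r'" "r' < np + nm" by (rule position_block[OF np])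
  note e = chi_exp_block[OF l(2), of q] chi_exp_block[OF l'(2), of q']
  consider "r < np" "r' < np" "q * np + r = q' * np + r'"
    | "\<not> r < np" "\<not> r' < np" "q * nm + (r - np) = q' * nm + (r' - np)"
    using eq unfolding l(1) l'(1) e
    by (cases "r < np"; cases "r' < np") (simp_all del: of_nat_add of_nat_mult)
  then show ?thesis
  proof cases
    case 1
    then show ?thesis using block_number_unique[OF 1(3)] l l' by simp
  next
    case 2
    have "r - np < nm" "r' - np < nm" using l(2) l'(2) 2 by linarith+
    from block_number_unique[OF 2(3) this] have "q = q'" "r - np = r' - np" .
    with 2 have "q = q'" "r = r'" by linarith+
    then show ?thesis using l l' by simp
  qed
qed

lemma chi_exp_surj:
  assumes np: "np \<ge> 1" and nm: "nm \<ge> 1"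
  shows "\<exists>l. chi_exp np nm l = m"
proof (cases "m \<ge> 0")
  case True
  define k where "k = nat m"
  have k: "m = int k" using True by (simp add: k_def)
  have r: "k mod np < np" using np by simp
  have "chi_exp np nm (k div np * (np + nm) + k mod np) = int (k div np * np + k mod np)"
    using r by (subst chi_exp_block) auto
  then show ?thesis using k by (metis div_mult_mod_eq)
next
  case False
  define k where "k = nat (- m - 1)"
  have k: "m = - int (k + 1)" using False by (simp add: k_def)
  have r: "k mod nm < nm" using nm by simp
  have "chi_exp np nm (k div nm * (np + nm) + (np + k mod nm))
      = - int (k div nm * nm + k mod nm + 1)"
    using r by (subst chi_exp_block) auto
  then show ?thesis using k by (metis div_mult_mod_eq)
qed

text \<open>The initial positions carry consecutive exponents. The two bounds below are the numbers of
  non-negative and of negative powers among the first \<open>n\<close> positions, so the exponents, being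
  pairwise distinct, fill the interval.\<close>

lemma initial_exponents_bounded:
  assumes np: "np \<ge> 1"
  shows "\<exists>a b. a + b = n \<and> (\<forall>l<n. - int b \<le> chi_exp np nm l \<and> chi_exp np nm l < int a)"
proof -
  obtain q' r' where n: "n = q' * (np + nm) + r'" "r' < np + nm" by (rule position_block[OF np])
  define a where "a = q' * np + min r' np"
  define b where "b = q' * nm + (r' - np)"
  have "a + b = n" by (simp add: a_def b_def n(1) algebra_simps)
  moreover have "- int b \<le> chi_exp np nm l \<and> chi_exp np nm l < int a" if "l < n" for l
  proof -
    obtain q r where l: "l = q * (np + nm) + r" "r < np + nm" by (rule position_block[OF np])
    have "l div (np + nm) = q" "n div (np + nm) = q'"
      unfolding l(1) n(1) using l(2) n(2) block_div by blast+
    then have "q \<le> q'" using div_le_mono[of l n "np + nm"] \<open>l < n\<close> by simp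
    then consider "q < q'" | "q = q'" "r < r'"
      using \<open>l < n\<close> l(1) n(1) by fastforce
    then have bounds: "(r < np \<longrightarrow> q * np + r < a) \<and> (\<not> r < np \<longrightarrow> q * nm + (r - np) + 1 \<le> b)"
    proof cases
      case 1
      then have "Suc q * np \<le> q' * np" "Suc q * nm \<le> q' * nm" by (intro mult_le_mono1; simp)+
      then show ?thesis using l(2) by (auto simp: a_def b_def)
    next
      case 2
      then show ?thesis using l(2) by (auto simp: a_def b_def)
    qed
    define x where "x = q * np + r"
    define y where "y = q * nm + (r - np) + 1"
    have "chi_exp np nm l = (if r < np then int x else - int y)"
      unfolding l(1) chi_exp_block[OF l(2)] x_def y_def ..
    moreover have "y > 0" by (simp add: y_def)
    ultimately show ?thesis using bounds[folded x_def y_def] by auto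
  qed
  ultimately show ?thesis by blast
qed

lemma initial_exponents_permutation:
  assumes np: "np \<ge> 1"
  obtains p b where "p permutes {0..<n}"
    "\<And>l. l < n \<Longrightarrow> int (p l) = chi_exp np nm l + int b"
proof -
  obtain a b where ab: "a + b = n"
    "\<And>l. l < n \<Longrightarrow> - int b \<le> chi_exp np nm l \<and> chi_exp np nm l < int a"
    using initial_exponents_bounded[OF np] by metis
  define p where "p = (\<lambda>l. if l < n then nat (chi_exp np nm l + int b) else l)"
  have p: "int (p l) = chi_exp np nm l + int b" if "l < n" for l
    using ab(2)[OF that] that by (simp add: p_def)
  have inj: "inj_on p {0..<n}"
  proof (rule inj_onI)
    fix l l' assume "l \<in> {0..<n}" "l' \<in> {0..<n}" "p l = p l'"
    then have "chi_exp np nm l = chi_exp np nm l'" using p[of l] p[of l'] by simp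
    then show "l = l'" by (rule chi_exp_inj[OF np])
  qed
  have "p ` {0..<n} \<subseteq> {0..<n}"
  proof
    fix y assume "y \<in> p ` {0..<n}"
    then obtain l where "l < n" "y = p l" by auto
    then have "int y < int n" using p ab by force
    then show "y \<in> {0..<n}" by simp
  qed
  then have "p ` {0..<n} = {0..<n}" using inj by (intro endo_inj_surj) auto
  then have "p permutes {0..<n}"
    using inj by (intro bij_imp_permutes) (auto simp: bij_betw_def p_def)
  then show thesis using p that by blast
qed


section \<open>The matrix of multiplication by \<open>z\<close> in the monomial basis\<close>

lemma Lambda_transpose_power:
  "smat_power (smat_transpose Lambda) n = (\<lambda>i j. if i = j + n then 1 else 0)"
proof (induction n)
  case 0
  then show ?case by (simp add: smat_power_def smat_one_def)
next
  case (Suc n)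
  have Lam: "Lambda i j = (if j = i + 1 then 1 else 0)" for i j
  proof -
    have "Lambda i j = (\<Sum>k\<in>{i}. matrix_unit k (k + 1) i j)"
      unfolding Lambda_def by (rule suminf_finite) (auto simp: matrix_unit_def)
    then show ?thesis by (simp add: matrix_unit_def)
  qed
  then have Lam_transpose: "smat_transpose Lambda i j = (if i = j + 1 then 1 else 0)" for i j
    by (simp add: smat_transpose_def)
  let ?P = "\<lambda>i j. if i = j + n then 1 else (0 :: complex)"
  have "smat_power (smat_transpose Lambda) (Suc n) = smat_transpose Lambda \<odot> ?P"
    using Suc.IH by (simp add: smat_power_def)
  also have "\<dots> = (\<lambda>i j. if i = j + Suc n then 1 else 0)"
  proof (intro ext)
    fix i j
    have "(smat_transpose Lambda \<odot> ?P) i j = (\<Sum>k\<in>{j + n}. smat_transpose Lambda i k * ?P k j)"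
      by (rule mult_eq_sum) auto
    then show "(smat_transpose Lambda \<odot> ?P) i j = (if i = j + Suc n then 1 else 0)"
      by (simp add: Lam_transpose)
  qed
  finally show ?case .
qed

lemma basis_vec_chi_index:
  assumes "np \<ge> 1" "nm \<ge> 1"
  shows "basis_vec (chi_index np nm m) i = (if chi_exp np nm i = m then 1 else 0)"
proof -
  obtain l where l: "chi_exp np nm l = m" using chi_exp_surj[OF assms] by blast
  then have "chi_index np nm m = l"
    unfolding chi_index_def using chi_exp_inj[OF assms(1)] by blast
  moreover have "chi_exp np nm i = m \<longleftrightarrow> i = l" using l chi_exp_inj[OF assms(1)] by metis
  ultimately show ?thesis by (simp add: basis_vec_def)
qed

text \<open>The summand \<open>\<Lambda>\<^sub>1\<close> raises the exponents from \<open>k \<ge> 0\<close> to \<open>k + 1\<close>, the transpose of \<open>\<Lambda>\<^sub>2\<close> those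
  from \<open>k \<le> -2\<close>, and the last summand, the matrix unit at \<open>(n\<^sub>+, 0)\<close>, joins the two chains: position
  \<open>n\<^sub>+\<close> carries \<open>z\<^sup>-\<^sup>1\<close> and position \<open>0\<close> carries \<open>1\<close>.\<close>

lemma Upsilon_entry:
  assumes np: "np \<ge> 1" and nm: "nm \<ge> 1"
  shows "Upsilon np nm i j = (if chi_exp np nm j = chi_exp np nm i + 1 then 1 else 0)"
proof -
  let ?e = "chi_exp np nm"
  have 1: "Lambda1 np nm i j = (if ?e i \<ge> 0 \<and> ?e j = ?e i + 1 then 1 else 0)"
  proof -
    have "Lambda1 np nm i j = (\<Sum>k\<in>{nat (?e i)}. e1 np nm k i * e1 np nm (k + 1) j)"
      unfolding Lambda1_def
      by (rule suminf_finite) (auto simp: e1_def basis_vec_chi_index[OF np nm])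
    then show ?thesis by (auto simp: e1_def basis_vec_chi_index[OF np nm])
  qed
  have 2: "smat_transpose (Lambda2 np nm) i j = (if ?e j \<le> -1 \<and> ?e j = ?e i + 1 then 1 else 0)"
  proof -
    have "Lambda2 np nm j i = (\<Sum>k\<in>{nat (- ?e j - 1)}. e2 np nm k j * e2 np nm (k + 1) i)"
      unfolding Lambda2_def
      by (rule suminf_finite) (auto simp: e2_def basis_vec_chi_index[OF np nm])
    then show ?thesis by (auto simp: e2_def basis_vec_chi_index[OF np nm] smat_transpose_def)
  qed
  have 3: "(matrix_unit np np \<odot> smat_power (smat_transpose Lambda) np) i j
      = (if ?e i = -1 \<and> ?e j = 0 then 1 else 0)"
  proof -
    have "?e np = -1" using chi_exp_block[of np np nm 0] nm by simp
    then have i: "?e i = -1 \<longleftrightarrow> i = np" using chi_exp_inj[OF np] by metis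
    have "?e 0 = 0" using chi_exp_block[of 0 np nm 0] np by simp
    then have j: "?e j = 0 \<longleftrightarrow> j = 0" using chi_exp_inj[OF np] by metis
    have "(matrix_unit np np \<odot> smat_power (smat_transpose Lambda) np) i j
      = (\<Sum>k\<in>{np}. matrix_unit np np i k * smat_power (smat_transpose Lambda) np k j)"
      by (rule mult_eq_sum) (auto simp: matrix_unit_def)
    then show ?thesis unfolding i j by (simp add: matrix_unit_def Lambda_transpose_power)
  qed
  show ?thesis unfolding Upsilon_def 1 2 3 by auto
qed

text \<open>Within a run of powers of one sign, adjacent exponents sit at adjacent positions; passing to
  the next block of the same sign jumps over a run of the other sign, of length \<open>n\<^sub>-\<close> or \<open>n\<^sub>+\<close>.
  The step from \<open>z\<^sup>-\<^sup>1\<close> to \<open>1\<close> leads from position \<open>n\<^sub>+\<close> back to position \<open>0\<close>.\<close>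

lemma Upsilon_band:
  assumes np: "np \<ge> 1" and nm: "nm \<ge> 1" and "Upsilon np nm i j \<noteq> 0"
  shows "i \<le> j + (np + 1)" "j \<le> i + (nm + 1)"
proof -
  let ?e = "chi_exp np nm"
  have succ: "?e j = ?e i + 1"
    using assms(3) by (simp add: Upsilon_entry[OF np nm] split: if_splits)
  have eqI: "j = j'" if "?e j' = ?e i + 1" for j'
    using that succ chi_exp_inj[OF np] by metis
  obtain q r where i: "i = q * (np + nm) + r" "r < np + nm" by (rule position_block[OF np])
  note ei = chi_exp_block[OF i(2), of q, folded i(1)]
  consider "Suc r < np" | "Suc r = np" | "r = np" "q = 0" | q0 where "r = np" "q = Suc q0"
    | "r > np"
    by (cases q; cases "Suc r < np \<or> Suc r = np \<or> r = np") (auto, linarith?)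
  then have "j = i + 1 \<or> j = i + (nm + 1) \<or> i = j + np \<or> i = j + (np + 1) \<or> i = j + 1"
  proof cases
    case 1
    have "?e (q * (np + nm) + Suc r) = ?e i + 1"
      using 1 i(2) by (subst chi_exp_block) (auto simp: ei)
    from eqI[OF this] show ?thesis using i by simp
  next
    case 2
    have "?e (Suc q * (np + nm) + 0) = ?e i + 1"
      using 2 np by (subst chi_exp_block) (auto simp: ei)
    from eqI[OF this] show ?thesis using i 2 by simp
  next
    case 3
    have "?e (0 * (np + nm) + 0) = ?e i + 1"
      using 3 np by (subst chi_exp_block) (auto simp: ei)
    from eqI[OF this] show ?thesis using i 3 by simp
  next
    case 4
    have "?e (q0 * (np + nm) + (np + (nm - 1))) = ?e i + 1"
      using 4 nm by (subst chi_exp_block) (auto simp: ei)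
    from eqI[OF this] show ?thesis using i 4 nm by simp
  next
    case 5
    have "?e (q * (np + nm) + (r - 1)) = ?e i + 1"
      using 5 i(2) by (subst chi_exp_block) (auto simp: ei)
    from eqI[OF this] show ?thesis using i 5 by simp
  qed
  then show "i \<le> j + (np + 1)" "j \<le> i + (nm + 1)" using np nm by auto
qed

lemma Upsilon_row_finite: "np \<ge> 1 \<Longrightarrow> nm \<ge> 1 \<Longrightarrow> row_finite (Upsilon np nm)"
  unfolding row_finite_def using Upsilon_band(2)
  by (metis (mono_tags, lifting) finite_nat_set_iff_bounded_le mem_Collect_eq)

lemma Upsilon_col_finite: "np \<ge> 1 \<Longrightarrow> nm \<ge> 1 \<Longrightarrow> col_finite (Upsilon np nm)"
  unfolding col_finite_def using Upsilon_band(1)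
  by (metis (mono_tags, lifting) finite_nat_set_iff_bounded_le mem_Collect_eq)

lemma Upsilon_mult_left:
  assumes np: "np \<ge> 1" and nm: "nm \<ge> 1" and k: "chi_exp np nm k = chi_exp np nm i + 1"
  shows "(Upsilon np nm \<odot> A) i j = A k j"
proof -
  have "(Upsilon np nm \<odot> A) i j = (\<Sum>l\<in>{k}. Upsilon np nm i l * A l j)"
  proof (rule mult_eq_sum)
    fix l assume "l \<notin> {k}"
    then have "chi_exp np nm l \<noteq> chi_exp np nm i + 1"
      using k chi_exp_inj[OF np, of nm l k] by auto
    then show "Upsilon np nm i l * A l j = 0" by (simp add: Upsilon_entry[OF np nm])
  qed simp
  then show ?thesis using k by (simp add: Upsilon_entry[OF np nm])
qed

lemma Upsilon_mult_right:
  assumes np: "np \<ge> 1" and nm: "nm \<ge> 1" and k: "chi_exp np nm j = chi_exp np nm k + 1"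
  shows "(A \<odot> Upsilon np nm) i j = A i k"
proof -
  have "(A \<odot> Upsilon np nm) i j = (\<Sum>l\<in>{k}. A i l * Upsilon np nm l j)"
  proof (rule mult_eq_sum)
    fix l assume "l \<notin> {k}"
    then have "chi_exp np nm l \<noteq> chi_exp np nm k" using chi_exp_inj[OF np, of nm l k] by auto
    then show "A i l * Upsilon np nm l j = 0" by (simp add: Upsilon_entry[OF np nm] k)
  qed simp
  then show ?thesis using k by (simp add: Upsilon_entry[OF np nm])
qed

text \<open>If an entry depends only on the difference of the exponents, then raising the exponent of
  the row and lowering that of the column have the same effect.\<close>

lemma Upsilon_commutes:
  assumes np: "np \<ge> 1" and nm: "nm \<ge> 1"
    and h: "\<And>i j. h i j = c (chi_exp np nm i - chi_exp np nm j)"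
  shows "Upsilon np nm \<odot> h = h \<odot> Upsilon np nm"
proof (intro ext)
  fix i j
  obtain k where k: "chi_exp np nm k = chi_exp np nm i + 1"
    using chi_exp_surj[OF np nm] by blast
  obtain l where l: "chi_exp np nm l = chi_exp np nm j - 1"
    using chi_exp_surj[OF np nm] by blast
  have "(Upsilon np nm \<odot> h) i j = h k j" by (rule Upsilon_mult_left[OF np nm k])
  moreover have "(h \<odot> Upsilon np nm) i j = h i l"
    by (rule Upsilon_mult_right[OF np nm]) (simp add: l)
  ultimately show "(Upsilon np nm \<odot> h) i j = (h \<odot> Upsilon np nm) i j"
    by (simp add: h k l algebra_simps)
qed

lemma Upsilon_chi:
  assumes "np \<ge> 1" "nm \<ge> 1" "z \<noteq> 0"
  shows "smat_app (Upsilon np nm) (chi np nm) i z = z * chi np nm i z"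
proof -
  obtain k where k: "chi_exp np nm k = chi_exp np nm i + 1"
    using chi_exp_surj[OF assms(1,2)] by blast
  have "smat_app (Upsilon np nm) (chi np nm) i z
      = (Upsilon np nm \<odot> (\<lambda>k _. chi np nm k z)) i 0"
    by (simp add: smat_app_def smat_mult_def)
  also have "\<dots> = chi np nm k z" by (rule Upsilon_mult_left[OF assms(1,2) k])
  finally show ?thesis using assms(3) by (simp add: chi_def k power_int_add)
qed


section \<open>Multiplication by \<open>z\<close> in a triangular basis\<close>

lemma laurent_monomials_independent:
  fixes e :: "'a \<Rightarrow> int" and a :: "'a \<Rightarrow> complex"
  assumes "finite F" "inj_on e F" "\<And>z. z \<noteq> 0 \<Longrightarrow> (\<Sum>k\<in>F. a k * z powi e k) = 0" "k \<in> F"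
  shows "a k = 0"
proof -
  \<comment> \<open>After multiplication by a power of \<open>z\<close> the combination is a polynomial with infinitely many
    zeros.\<close>
  define m where "m = Min (e ` F)"
  have m: "m \<le> e l" if "l \<in> F" for l using that assms(1) by (simp add: m_def)
  define p where "p = (\<Sum>l\<in>F. Polynomial.monom (a l) (nat (e l - m)))"
  have "poly p z = 0" if "z \<noteq> 0" for z
  proof -
    have "poly p z = (\<Sum>l\<in>F. a l * z ^ nat (e l - m))"
      by (simp add: p_def poly_sum poly_monom)
    also have "\<dots> = (\<Sum>l\<in>F. a l * z powi e l * z powi (- m))"
    proof (rule sum.cong)
      fix l assume "l \<in> F"
      then have "z ^ nat (e l - m) = z powi (e l + - m)"
        using m by (simp add: power_int_def)
      also have "\<dots> = z powi e l * z powi (- m)" using that by (intro power_int_add) auto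
      finally show "a l * z ^ nat (e l - m) = a l * z powi e l * z powi (- m)" by simp
    qed simp
    also have "\<dots> = 0" using assms(3)[OF that] by (simp flip: sum_distrib_right)
    finally show ?thesis .
  qed
  then have "- {0} \<subseteq> {z. poly p z = 0}" by auto
  moreover have "infinite (- {0 :: complex})"
    by (simp add: infinite_UNIV_char_0 Compl_eq_Diff_UNIV)
  ultimately have "p = 0" using poly_roots_finite finite_subset by blast
  then have "0 = (\<Sum>l\<in>F. if nat (e l - m) = nat (e k - m) then a l else 0)"
    by (simp add: p_def flip: coeff_monom coeff_sum)
  also have "\<dots> = (\<Sum>l\<in>F. if l = k then a l else 0)"
    using m assms(2,4) by (intro sum.cong) (auto dest: inj_onD simp: eq_nat_nat_iff)
  finally show ?thesis using assms(1,4) by simp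
qed

lemma smat_app_eq_sum:
  assumes "finite F" "\<And>k. k \<notin> F \<Longrightarrow> A i k = 0"
  shows "smat_app A v i z = (\<Sum>k\<in>F. A i k * v k z)"
  unfolding smat_app_def by (rule suminf_finite) (use assms in auto)

lemma smat_app_mult:
  assumes "row_finite A" "row_finite B"
  shows "smat_app (A \<odot> B) v i z = smat_app A (smat_app B v) i z"
proof -
  have "smat_app C w i z = (C \<odot> (\<lambda>k _. w k z)) i 0" for C w i
    by (simp add: smat_app_def smat_mult_def)
  moreover have "(\<lambda>k _. smat_app B v k z) = B \<odot> (\<lambda>k _. v k z)"
    by (simp add: smat_app_def smat_mult_def)
  ultimately show ?thesis by (simp add: mult_assoc_row[OF assms])
qed

lemma smat_app_chi_inj:
  assumes np: "np \<ge> 1" and "row_finite A" "row_finite B"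
    and eq: "\<And>i z. z \<noteq> 0 \<Longrightarrow> smat_app A (chi np nm) i z = smat_app B (chi np nm) i z"
  shows "A = B"
proof (intro ext)
  fix i k
  let ?F = "{j. A i j \<noteq> 0} \<union> {j. B i j \<noteq> 0}"
  have F: "finite ?F" using assms by (simp add: row_finite_def)
  show "A i k = B i k"
  proof (cases "k \<in> ?F")
    case True
    have "A i k - B i k = 0"
    proof (rule laurent_monomials_independent[OF F _ _ True])
      show "inj_on (chi_exp np nm) ?F" using chi_exp_inj[OF np] by (blast intro: inj_onI)
      fix z :: complex assume "z \<noteq> 0"
      moreover have "smat_app A (chi np nm) i z = (\<Sum>k\<in>?F. A i k * chi np nm k z)"
        by (rule smat_app_eq_sum[OF F]) auto
      moreover have "smat_app B (chi np nm) i z = (\<Sum>k\<in>?F. B i k * chi np nm k z)"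
        by (rule smat_app_eq_sum[OF F]) auto
      ultimately show "(\<Sum>k\<in>?F. (A i k - B i k) * z powi chi_exp np nm k) = 0"
        using eq by (simp add: left_diff_distrib sum_subtractf flip: chi_def)
    qed
    then show ?thesis by simp
  qed auto
qed

lemma mult_entry_nonzeroE:
  assumes "(A \<odot> B) i j \<noteq> 0"
  obtains k where "A i k \<noteq> 0" "B k j \<noteq> 0"
proof (rule ccontr)
  assume "\<not> thesis"
  with that have "A i k * B k j = 0" for k by auto
  then have "(A \<odot> B) i j = (\<Sum>k\<in>{}. A i k * B k j)" by (intro mult_eq_sum) blast+
  then have "(A \<odot> B) i j = 0" by simp
  with assms show False ..
qed

text \<open>The matrix of multiplication by \<open>z\<close> in the basis \<open>M \<chi>\<close> is \<open>M \<Upsilon> M\<^sup>-\<^sup>1\<close>, whose upper bandwidth is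
  that of \<open>\<Upsilon>\<close> because \<open>M\<close> is lower triangular. As \<open>h\<close> commutes with \<open>\<Upsilon>\<close>, the same matrix is
  \<open>U \<Upsilon> U\<^sup>-\<^sup>1\<close>, whose lower bandwidth is that of \<open>\<Upsilon>\<close> because \<open>U\<close> is upper triangular.\<close>

lemma mult_z_band_structure_triangular_basis:
  assumes np: "np \<ge> 1" and nm: "nm \<ge> 1"
    and M: "lower_triangular_smat M" "nonzero_diagonal M"
    and U: "upper_triangular_smat U" "nonzero_diagonal U"
    and MU: "M \<odot> h = U"
    and h: "\<And>i j. h i j = c (chi_exp np nm i - chi_exp np nm j)"
  shows "mult_z_band_structure (np + nm + 3) (smat_app M (chi np nm))"
proof -
  let ?Y = "Upsilon np nm" and ?\<Phi> = "smat_app M (chi np nm)"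
  obtain M' where M': "lower_triangular_smat M'" "M \<odot> M' = smat_one" "M' \<odot> M = smat_one"
    using lower_inverse[OF M] by metis
  obtain U' where U': "upper_triangular_smat U'" "U \<odot> U' = smat_one"
    using upper_inverse[OF U] by metis
  note Yr = Upsilon_row_finite[OF np nm] and Yc = Upsilon_col_finite[OF np nm]
  note Mr = lower_row_finite[OF M(1)] and M'r = lower_row_finite[OF M'(1)]
  note Uc = upper_col_finite[OF U(1)] and U'c = upper_col_finite[OF U'(1)]
  define J where "J = (M \<odot> ?Y) \<odot> M'"
  have Jr: "row_finite J" unfolding J_def by (intro row_finite_mult Mr Yr M'r)
  have JM: "J \<odot> M = M \<odot> ?Y"
    unfolding J_def by (simp add: mult_assoc_row[OF row_finite_mult[OF Mr Yr] M'r] M'(3))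
  have z\<Phi>: "z * ?\<Phi> i z = smat_app (M \<odot> ?Y) (chi np nm) i z" if "z \<noteq> 0" for i z
  proof -
    have sum: "smat_app M v i z = (\<Sum>k<Suc i. M i k * v k z)" for v
      by (rule smat_app_eq_sum) (use M(1) in \<open>auto simp: lower_triangular_smat_def\<close>)
    have "smat_app (M \<odot> ?Y) (chi np nm) i z = smat_app M (smat_app ?Y (chi np nm)) i z"
      by (rule smat_app_mult[OF Mr Yr])
    also have "\<dots> = (\<Sum>k<Suc i. z * (M i k * chi np nm k z))"
      unfolding sum Upsilon_chi[OF np nm that] by (simp add: mult.left_commute)
    also have "\<dots> = z * ?\<Phi> i z" unfolding sum sum_distrib_left ..
    finally show ?thesis ..
  qed
  have J: "mult_z_matrix ?\<Phi> J"
    unfolding mult_z_matrix_def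
    using Jr z\<Phi> by (simp add: smat_app_mult[OF Jr Mr, symmetric] JM row_finite_def)
  have uniq: "K = J" if K: "mult_z_matrix ?\<Phi> K" for K
  proof -
    have Kr: "row_finite K" using K by (simp add: mult_z_matrix_def row_finite_def)
    have "K \<odot> M = M \<odot> ?Y"
    proof (rule smat_app_chi_inj[OF np row_finite_mult[OF Kr Mr] row_finite_mult[OF Mr Yr]])
      fix i and z :: complex assume "z \<noteq> 0"
      then show "smat_app (K \<odot> M) (chi np nm) i z = smat_app (M \<odot> ?Y) (chi np nm) i z"
        using K z\<Phi> by (simp add: mult_z_matrix_def smat_app_mult[OF Kr Mr])
    qed
    then have "(K \<odot> M) \<odot> M' = J" by (simp add: J_def)
    then show ?thesis by (simp add: mult_assoc_row[OF Kr Mr] M'(2))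
  qed
  have "J \<odot> U = (M \<odot> ?Y) \<odot> ((M' \<odot> M) \<odot> h)"
    unfolding J_def MU[symmetric] mult_assoc_row[OF M'r Mr]
    by (rule mult_assoc_row[OF row_finite_mult[OF Mr Yr] M'r])
  also have "\<dots> = M \<odot> (h \<odot> ?Y)"
    using Upsilon_commutes[where h = h and c = c, OF np nm h]
    by (simp add: M'(3) mult_assoc_row[OF Mr Yr])
  also have "\<dots> = U \<odot> ?Y"
    unfolding MU[symmetric] by (rule mult_assoc_row_col[OF Mr Yc, symmetric])
  finally have "(J \<odot> U) \<odot> U' = (U \<odot> ?Y) \<odot> U'" by simp
  then have JU: "J = (U \<odot> ?Y) \<odot> U'" by (simp add: mult_assoc_col[OF Uc U'c] U'(2))
  have "banded (np + nm + 3) J"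
    unfolding banded_def
  proof (intro exI conjI allI impI)
    show "(np + 1) + (nm + 1) + 1 = np + nm + 3" by simp
    fix i j assume nz: "J i j \<noteq> 0"
    obtain k l where "M i l \<noteq> 0" "?Y l k \<noteq> 0" "M' k j \<noteq> 0"
      using nz unfolding J_def by (metis mult_entry_nonzeroE)
    moreover from this have "l \<le> i" "j \<le> k"
      using M(1) M'(1) by (auto simp: lower_triangular_smat_def not_less[symmetric])
    ultimately show "j \<le> i + (nm + 1)" using Upsilon_band(2)[OF np nm] by fastforce
    obtain k l where "U i l \<noteq> 0" "?Y l k \<noteq> 0" "U' k j \<noteq> 0"
      using nz unfolding JU by (metis mult_entry_nonzeroE)
    moreover from this have "i \<le> l" "k \<le> j"
      using U(1) U'(1) by (auto simp: upper_triangular_smat_def not_less[symmetric])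
    ultimately show "i \<le> j + (np + 1)" using Upsilon_band(1)[OF np nm] by fastforce
  qed
  with J uniq show ?thesis unfolding mult_z_band_structure_def by blast
qed


section \<open>The moment matrix\<close>

lemma sets_upper_variation: "sets (upper_variation \<rho>) = sets borel"
  unfolding upper_variation_def
  using sets.sigma_sets_eq[of "borel :: complex measure"] by (simp add: sets_measure_of_conv)

text \<open>A set function that is not countably additive is replaced by the zero measure in \<open>measure_of\<close>,
  so in every case the upper variation of a set is bounded by the supremum over its Borel subsets,
  and this supremum vanishes off \<open>T\<close>.\<close>

lemma AE_upper_variation:
  assumes "\<And>A. A \<in> sets borel \<Longrightarrow> A \<inter> T = {} \<Longrightarrow> \<rho> A = 0" and T: "T \<in> sets borel"
  shows "AE z in upper_variation \<rho>. z \<in> T"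
proof -
  let ?f = "\<lambda>A. SUP B \<in> {B \<in> sets borel. B \<subseteq> A}. ennreal (\<rho> B)"
  have space: "space (upper_variation \<rho>) = UNIV"
    by (simp add: upper_variation_def space_measure_of_conv)
  have "?f (- T) \<le> 0"
  proof (rule SUP_least)
    fix B assume "B \<in> {B \<in> sets borel. B \<subseteq> - T}"
    then have "\<rho> B = 0" by (intro assms(1)) auto
    then show "ennreal (\<rho> B) \<le> 0" by simp
  qed
  then have "emeasure (upper_variation \<rho>) (- T) = 0"
    unfolding upper_variation_def emeasure_measure_of_conv by simp
  moreover have "- T \<in> sets (upper_variation \<rho>)" using T by (auto simp: sets_upper_variation)
  ultimately have "- T \<in> null_sets (upper_variation \<rho>)" by (auto simp: null_sets_def)
  then show ?thesis by (rule AE_I') (auto simp: space)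
qed

lemma complex_integral_cong_support:
  assumes "supported_on \<mu> T" and T: "T \<in> sets borel"
    and f: "f \<in> borel_measurable borel" and g: "g \<in> borel_measurable borel"
    and eq: "\<And>z. z \<in> T \<Longrightarrow> f z = g z"
  shows "complex_integral \<mu> f = complex_integral \<mu> g"
proof -
  have "(LINT z|upper_variation \<rho>. f z) = (LINT z|upper_variation \<rho>. g z)"
    if "\<And>A. \<mu> A = 0 \<Longrightarrow> \<rho> A = 0" for \<rho>
  proof (rule integral_cong_AE)
    show "f \<in> borel_measurable (upper_variation \<rho>)" "g \<in> borel_measurable (upper_variation \<rho>)"
      using f g measurable_cong_sets[OF sets_upper_variation refl] by blast+
    have "AE z in upper_variation \<rho>. z \<in> T"
      by (rule AE_upper_variation[OF _ T]) (use assms(1) that in \<open>auto simp: supported_on_def\<close>)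
    then show "AE z in upper_variation \<rho>. f z = g z" by eventually_elim (rule eq)
  qed
  then show ?thesis unfolding complex_integral_def by simp
qed

lemma powi_borel_measurable [measurable]:
  "(\<lambda>z :: complex. z powi k) \<in> borel_measurable borel"
  by (cases "k \<ge> 0") (simp_all add: power_int_def)

lemma moment_matrix_entry:
  assumes "supported_on \<mu> (sphere 0 1)"
  shows "moment_matrix \<mu> np nm i j
    = complex_integral \<mu> (\<lambda>z. z powi (chi_exp np nm i - chi_exp np nm j))"
  unfolding moment_matrix_def
proof (rule complex_integral_cong_support[OF assms])
  show "(\<lambda>z. chi np nm i z * cnj (chi np nm j z)) \<in> borel_measurable borel"
  proof -
    have [measurable]: "cnj \<in> borel_measurable borel"
      by (intro borel_measurable_continuous_onI continuous_intros)
    show ?thesis unfolding chi_def by measurable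
  qed
  fix z :: complex assume "z \<in> sphere 0 1"
  then have "norm z = 1" by simp
  then have "z \<noteq> 0" "cnj z = inverse z"
    by (auto simp: inverse_complex_def complex_eq_iff cmod_def)
  then show "chi np nm i z * cnj (chi np nm j z) = z powi (chi_exp np nm i - chi_exp np nm j)"
    by (simp add: chi_def power_int_inverse power_int_diff divide_inverse)
qed auto

text \<open>Each section of the moment matrix arises from a Toeplitz matrix by permuting rows and columns
  simultaneously, because the initial positions carry consecutive exponents.\<close>

lemma section_det_moment_matrix:
  assumes "supported_on \<mu> (sphere 0 1)" "quasi_definite \<mu>" and np: "np \<ge> 1"
  shows "section_det (moment_matrix \<mu> np nm) n \<noteq> 0"
proof -
  define c where "c = (\<lambda>k. complex_integral \<mu> (\<lambda>z. z powi k))"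
  obtain p b where p: "p permutes {0..<n}" "\<And>l. l < n \<Longrightarrow> int (p l) = chi_exp np nm l + int b"
    using initial_exponents_permutation[OF np] by metis
  define T where "T = Matrix.mat n n (\<lambda>(i, j). c (int i - int j))"
  define T1 where "T1 = Matrix.mat n n (\<lambda>(i, j). T $$ (p i, j))"
  define G where "G = Matrix.mat n n (\<lambda>(i, j). moment_matrix \<mu> np nm i j)"
  have carr: "T \<in> carrier_mat n n" "T1 \<in> carrier_mat n n" "G \<in> carrier_mat n n"
    by (simp_all add: T_def T1_def G_def)
  have T1_transpose: "transpose_mat T1 \<in> carrier_mat n n" using carr(2) by simp
  have det_T: "Determinant.det T \<noteq> 0"
  proof (cases n)
    case 0
    then show ?thesis using carr by simp
  next
    case (Suc m)
    then show ?thesis using assms(2) by (simp add: quasi_definite_def T_def c_def)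
  qed
  have lt: "p i < n" if "i < n" for i
    using permutes_in_image[OF p(1), of i] that by simp
  \<comment> \<open>The rows of the Toeplitz matrix are permuted first, then, after transposing, its columns.\<close>
  have "transpose_mat G = Matrix.mat n n (\<lambda>(i, j). transpose_mat T1 $$ (p i, j))"
  proof (rule eq_matI)
    fix i j
    assume "i < dim_row (Matrix.mat n n (\<lambda>(i, j). transpose_mat T1 $$ (p i, j)))"
      and "j < dim_col (Matrix.mat n n (\<lambda>(i, j). transpose_mat T1 $$ (p i, j)))"
    then have ij: "i < n" "j < n" by simp_all
    then have "moment_matrix \<mu> np nm j i = c (int (p j) - int (p i))"
      by (simp add: moment_matrix_entry[OF assms(1)] p(2) c_def)
    then show "transpose_mat G $$ (i, j)
        = Matrix.mat n n (\<lambda>(i, j). transpose_mat T1 $$ (p i, j)) $$ (i, j)"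
      using ij lt by (simp add: G_def T1_def T_def)
  qed (use carr in auto)
  then have "Determinant.det G = signof p * (signof p * Determinant.det T)"
    using det_permute_rows[OF carr(1) p(1)] det_permute_rows[OF T1_transpose p(1)]
      Determinant.det_transpose[OF carr(2)] Determinant.det_transpose[OF carr(3)]
    by (simp add: T1_def)
  then show ?thesis using det_T by (simp add: section_det_def G_def sign_def)
qed

theorem proposition23:
  fixes \<mu> :: "complex set \<Rightarrow> complex" and np nm :: nat
  assumes "complex_borel_measure \<mu>"
    and "supported_on \<mu> (sphere 0 1)"
    and "quasi_definite \<mu>"
    and "np \<ge> 1" and "nm \<ge> 1"
  shows "Upsilon np nm \<odot> moment_matrix \<mu> np nm = moment_matrix \<mu> np nm \<odot> Upsilon np nm
    \<and> mult_z_band_structure (np + nm + 3) (Phi1 \<mu> np nm)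
    \<and> mult_z_band_structure (np + nm + 3) (Phi2 \<mu> np nm)"
proof (intro conjI)
  define g where "g = moment_matrix \<mu> np nm"
  define c where "c = (\<lambda>k. complex_integral \<mu> (\<lambda>z. z powi k))"
  define L where "L = S1 \<mu> np nm"
  define U where "U = S2 \<mu> np nm"
  have g: "g i j = c (chi_exp np nm i - chi_exp np nm j)" for i j
    by (simp add: g_def c_def moment_matrix_entry[OF assms(2)])
  show "Upsilon np nm \<odot> moment_matrix \<mu> np nm = moment_matrix \<mu> np nm \<odot> Upsilon np nm"
    using Upsilon_commutes[where h = g and c = c, OF assms(4,5) g] by (simp add: g_def)
  have det: "section_det g n \<noteq> 0" for n
    unfolding g_def by (rule section_det_moment_matrix[OF assms(2-4)])
  have "gauss_factors g = (L, U)" by (simp add: L_def U_def S1_def S2_def g_def)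
  note LU = gauss_factors_properties[OF det this]
  have L: "lower_triangular_smat L" "nonzero_diagonal L"
    using LU(1)
    by (auto simp: unit_lower_triangular_def lower_triangular_smat_def nonzero_diagonal_def)
  show "mult_z_band_structure (np + nm + 3) (Phi1 \<mu> np nm)"
    unfolding Phi1_def L_def[symmetric]
    by (rule mult_z_band_structure_triangular_basis
          [where h = g and c = c, OF assms(4,5) L LU(2,3,4) g])

  obtain L' where L': "lower_triangular_smat L'" "nonzero_diagonal L'" "L' \<odot> L = smat_one"
    using lower_inverse[OF L] by metis
  obtain U' where U': "upper_triangular_smat U'" "nonzero_diagonal U'"
      "U \<odot> U' = smat_one" "U' \<odot> U = smat_one"
    using upper_inverse[OF LU(2,3)] .
  have "L' \<odot> U = g"
    using mult_assoc_row[OF lower_row_finite[OF L'(1)] lower_row_finite[OF L(1)], of g] LU(4) L'(3)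
    by simp
  then have "g \<odot> U' = L'"
    using mult_assoc_col[OF upper_col_finite[OF LU(2)] upper_col_finite[OF U'(1)], of L'] U'(3)
    by simp
  then have "smat_adjoint U' \<odot> smat_adjoint g = smat_adjoint L'"
    using adjoint_mult[OF upper_col_finite[OF U'(1)], of g] by simp
  moreover have "smat_adjoint g i j = (\<lambda>k. cnj (c (- k))) (chi_exp np nm i - chi_exp np nm j)"
    for i j by (simp add: smat_adjoint_def g)
  moreover have "nonzero_diagonal (smat_adjoint U')" "nonzero_diagonal (smat_adjoint L')"
    using U'(2) L'(2) by (simp_all add: nonzero_diagonal_def smat_adjoint_def)
  ultimately have "mult_z_band_structure (np + nm + 3) (smat_app (smat_adjoint U') (chi np nm))"
    using U'(1) L'(1)
    by (intro mult_z_band_structure_triangular_basis[where h = "smat_adjoint g"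
          and c = "\<lambda>k. cnj (c (- k))" and U = "smat_adjoint L'", OF assms(4,5)]) simp_all
  moreover have "smat_inv U = U'" by (rule smat_inv_upper[OF LU(2) U'(1,3,4)])
  ultimately show "mult_z_band_structure (np + nm + 3) (Phi2 \<mu> np nm)"
    unfolding Phi2_def U_def by simp
qed

end
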